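(* Let $\mathcal{M}=(S,A,\mathcal{T})$ be a finite MDP for which there exists some stationary policy such that the resulting Markov chain on $S$ is irreducible. Let $\mathcal{V}\subseteq S$ be the set of target states to be covered and $s_0\in S$ the initial state of the agent. Then, starting from a proper policy, policy iteration on the product MDP $\mathcal{M}_p=(S_p,A,\mathcal{T}_p)$ with reward function $R_p$ returns an optimal stationary deterministic policy $\pi^*:S_p\to A$ for the minimum expected cover time problem $$\pi^*=\arg\min_{\pi}\ \mathbb{E}^{\pi}\big[C_{s_0}^{\mathcal{V}}\big].$$
   Context: A finite Markov decision process (MDP) is a tuple $(S,A,\mathcal{T})$ with finite state set $S$, finite action set $A$, and transition probabilities $\mathcal{T}:S\times A\times S\to[0,1]$ with $\sum_{s'\in S}\mathcal{T}(s,a,s')=1$ for all $s\in S$, $a\in A$. A Markov chain is irreducible if for every pair of states $s,s'$ the agent can reach $s'$ from $s$ in a finite number of steps with non-zero probability. Only deterministic policies are considered. Cover time: for the process $X_t$ of the agent's locations under policy $\pi$ with $X_0=s_0$, the hitting time of $s$ is $H_{s_0}^{s,\pi}=\min\{t:X_t=s\}$ and the cover time of $\mathcal{V}$ is $C_{s_0}^{\mathcal{V},\pi}=\min\{t:H_{s_0}^{s,\pi}\le t\text{ for all }s\in\mathcal{V}\}$; $\mathbb{E}^\pi[C_{s_0}^{\mathcal{V}}]=\mathbb{E}[C_{s_0}^{\mathcal{V},\pi}]$. Product MDP: $S_p=S\times2^{\mathcal{V}}$; the extended state $(s,\overline{\mathcal{V}})$ encodes the current location $s\in S$ and the remaining set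 $\overline{\mathcal{V}}\subseteq\mathcal{V}$ of states to be visited. Transitions: $\mathcal{T}_p((s_1,\overline{\mathcal{V}}_1),a,(s_2,\overline{\mathcal{V}}_2))=\mathcal{T}(s_1,a,s_2)$ if $\overline{\mathcal{V}}_2=\overline{\mathcal{V}}_1\setminus\{s_2\}$, and $0$ otherwise. Reward: $R_p(s,\overline{\mathcal{V}})=0$ if $\overline{\mathcal{V}}\in\{\emptyset,\{s\}\}$ and $-1$ otherwise. Extended states with $\overline{\mathcal{V}}\in\{\emptyset,\{s\}\}$ are the target states of the product problem: there the required set has already been covered, the agent incurs no further cost, and the value is $0$. A stationary deterministic policy on the product MDP is a map $\pi:S_p\to A$; its value function is $V^\pi(s,\overline{\mathcal{V}})=-\mathbb{E}^\pi[C_s^{\overline{\mathcal{V}}}]$, so that the minimum expected cover time problem has the same solution as $\arg\max_\pi V^\pi(s_0,\mathcal{V})$. Proper policy: a stationary deterministic policy is proper if, when using it, there is a positive probability that the agent will eventually reach a target state of the product problem, for all initial extended states. Policy iteration: given the current policy $\pi$, (1) compute its value function, which is $0$ at the target states and satisfies $$V^\pi(s,\overline{\mathcal{V}})=-1+\sum_{s'\in S}\mathcal{T}_p\big((s,\overline{\mathcal{V}}),\pi(s,\overline{\mathcal{V}}),(s',\overline{\mathcal{V}}\setminus\{s'\})\big)V^\pi(s',\overline{\mathcal{V}}\setminus\{s'\})$$ at the other extended states; (2) compute the new policy $$\pi_{\rm new}(s,\overline{\mathcal{V}})=\arg\max_{a\in A}\sum_{s'\in S}\mathcal{T}_p\big((s,\overline{\mathcal{V}}),a,(s',\overline{\mathcal{V}}\setminus\{s'\})\big)\big(R_p(s,\overline{\mathcal{V}})+V^\pi(s',\overline{\mathcal{V}}\setminus\{s'\})\big).$$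 The two steps are repeated until the old policy and the new policy are exactly the same.
   Formalization: The process starts in the extended state (s_0, V\{s_0}) instead of (s_0, V), since for s_0 in V the literal claim fails (s_0 would have to be visited again); and arg max breaks ties by a fixed rule, as otherwise the iteration need not stop. *)

theory Defs
  imports "HOL-Probability.Probability"
begin

section \<open>Markov chains with discrete transition kernels\<close>

definition chain_kernel :: "('x \<Rightarrow> 'x pmf) \<Rightarrow> 'x \<Rightarrow> nat \<Rightarrow> (nat \<Rightarrow> 'x) \<Rightarrow> 'x measure" where
  "chain_kernel K x i \<omega> =
     measure_pmf (case i of 0 \<Rightarrow> return_pmf x | Suc j \<Rightarrow> K (\<omega> j))"

lemma Ionescu_Tulcea_chain_kernel:
  fixes K :: "'x \<Rightarrow> 'x pmf"
  shows "Ionescu_Tulcea (chain_kernel K x) (\<lambda>_. count_space UNIV)"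
proof (rule Ionescu_Tulcea.intro, goal_cases)
  case (1 i)
  show ?case
  proof (cases i)
    case 0
    then show ?thesis
      by (simp add: chain_kernel_def[abs_def] measure_pmf_in_subprob_algebra)
  next
    case (Suc j)
    have "(\<lambda>\<omega>. \<omega> j) \<in> measurable (PiM {0..<i} (\<lambda>_. count_space UNIV)) (count_space (UNIV :: 'x set))"
      using Suc by (intro measurable_component_singleton) auto
    moreover have "(\<lambda>y. measure_pmf (K y)) \<in> measurable (count_space UNIV) (subprob_algebra (count_space UNIV))"
      by (simp add: measure_pmf_in_subprob_algebra)
    ultimately have "(\<lambda>\<omega>. measure_pmf (K (\<omega> j))) \<in>
        measurable (PiM {0..<i} (\<lambda>_. count_space UNIV)) (subprob_algebra (count_space UNIV))"
      by (rule measurable_compose)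
    then show ?thesis
      using Suc by (simp add: chain_kernel_def[abs_def])
  qed
next
  case (2 i \<omega>)
  show ?case
    unfolding chain_kernel_def by (rule prob_space_measure_pmf)
qed

text \<open>The law of the trajectory \<open>X\<^sub>0, X\<^sub>1, \<dots>\<close> of the chain with transition kernel \<open>K\<close>
  and \<open>X\<^sub>0 = x\<close>, obtained from the Ionescu-Tulcea construction.\<close>

definition path_measure :: "('x \<Rightarrow> 'x pmf) \<Rightarrow> 'x \<Rightarrow> (nat \<Rightarrow> 'x) measure" where
  "path_measure K x =
     projective_family.lim UNIV
       (Ionescu_Tulcea.CI (chain_kernel K x) (\<lambda>_. count_space UNIV)) (\<lambda>_. count_space UNIV)"

lemma sets_path_measure:
  fixes K :: "'x \<Rightarrow> 'x pmf"
  shows "sets (path_measure K x) = sets (PiM UNIV (\<lambda>_. count_space UNIV))"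
proof -
  interpret Ionescu_Tulcea "chain_kernel K x" "\<lambda>_. count_space UNIV"
    by (rule Ionescu_Tulcea_chain_kernel)
  show ?thesis
    unfolding path_measure_def by (rule PF.sets_lim)
qed

lemma distr_path_measure:
  fixes K :: "'x \<Rightarrow> 'x pmf"
  assumes "finite J"
  shows "distr (path_measure K x) (PiM J (\<lambda>_. count_space UNIV)) (\<lambda>\<omega>. restrict \<omega> J) =
    Ionescu_Tulcea.CI (chain_kernel K x) (\<lambda>_. count_space UNIV) J"
proof -
  interpret Ionescu_Tulcea "chain_kernel K x" "\<lambda>_. count_space UNIV"
    by (rule Ionescu_Tulcea_chain_kernel)
  show ?thesis
    unfolding path_measure_def by (rule distr_lim[OF assms])
qed

definition irreducible_chain :: "('x \<Rightarrow> 'x pmf) \<Rightarrow> bool" where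
  "irreducible_chain K \<longleftrightarrow>
     (\<forall>x y. \<exists>n. measure (path_measure K x) {\<omega>. \<omega> n = y} > 0)"

section \<open>Cover times\<close>

definition hitting_time :: "(nat \<Rightarrow> 's) \<Rightarrow> 's \<Rightarrow> enat" where
  "hitting_time X s = (INF t \<in> {t. X t = s}. enat t)"

definition cover_time :: "'s set \<Rightarrow> (nat \<Rightarrow> 's) \<Rightarrow> enat" where
  "cover_time V X = (INF t \<in> {t. \<forall>s\<in>V. hitting_time X s \<le> enat t}. enat t)"

section \<open>The product MDP\<close>

text \<open>An MDP with state set \<open>UNIV :: 's set\<close> and action set \<open>UNIV :: 'a set\<close> (both types of class
  \<open>finite\<close>) is given by its transition kernel \<open>T\<close>.\<close>

type_synonym 's ext_state = "'s \<times> 's set"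

definition ext_states :: "'s set \<Rightarrow> 's ext_state set" where
  "ext_states V = UNIV \<times> Pow V"

definition target_states :: "'s ext_state set" where
  "target_states = {(s, W). W = {} \<or> W = {s}}"

definition product_transition ::
    "('s \<Rightarrow> 'a \<Rightarrow> 's pmf) \<Rightarrow> 's ext_state \<Rightarrow> 'a \<Rightarrow> 's ext_state pmf" where
  "product_transition T x a =
     (case x of (s, W) \<Rightarrow> map_pmf (\<lambda>s'. (s', W - {s'})) (T s a))"

lemma pmf_product_transition:
  "pmf (product_transition T (s1, W1) a) (s2, W2) =
     (if W2 = W1 - {s2} then pmf (T s1 a) s2 else 0)"
proof (cases "W2 = W1 - {s2}")
  case True
  have "inj (\<lambda>s'. (s', W1 - {s'}))"
    by (auto intro: injI)
  then show ?thesis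
    using True pmf_map_inj'[of "\<lambda>s'. (s', W1 - {s'})" "T s1 a" s2]
    by (simp add: product_transition_def)
next
  case False
  then have "(s2, W2) \<notin> set_pmf (product_transition T (s1, W1) a)"
    by (auto simp: product_transition_def)
  then show ?thesis
    using False by (simp add: set_pmf_iff)
qed

definition product_reward :: "'s ext_state \<Rightarrow> real" where
  "product_reward x = (case x of (s, W) \<Rightarrow> if W \<in> {{}, {s}} then 0 else -1)"

definition policies :: "'s set \<Rightarrow> ('s ext_state \<Rightarrow> 'a) set" where
  "policies V = (ext_states V \<rightarrow>\<^sub>E UNIV)"

definition policy_paths ::
    "('s \<Rightarrow> 'a \<Rightarrow> 's pmf) \<Rightarrow> ('s ext_state \<Rightarrow> 'a) \<Rightarrow> 's ext_state \<Rightarrow> (nat \<Rightarrow> 's ext_state) measure" where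
  "policy_paths T \<pi> = path_measure (\<lambda>x. product_transition T x (\<pi> x))"

text \<open>At time \<open>t\<close> the agent is at \<open>X\<^sub>t\<close>, the states of \<open>V\<close> remaining to be visited are
  \<open>V - {X\<^sub>0, \<dots>, X\<^sub>t}\<close>, and it plays \<open>\<pi> (X\<^sub>t, V - {X\<^sub>0, \<dots>, X\<^sub>t})\<close>. As \<open>X\<^sub>0 = s\<^sub>0\<close> counts as
  visited at time \<open>0\<close> (its hitting time is \<open>0\<close>), the initial extended state is
  \<open>(s\<^sub>0, V - {s\<^sub>0})\<close>, which is \<open>(s\<^sub>0, V)\<close> unless \<open>s\<^sub>0 \<in> V\<close>. Starting from \<open>(s\<^sub>0, V)\<close> with
  \<open>s\<^sub>0 \<in> V\<close> instead would make the product transitions ask for a second visit of \<open>s\<^sub>0\<close>,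
  because they never remove the state that is being left.\<close>

definition expected_cover_time ::
    "('s \<Rightarrow> 'a \<Rightarrow> 's pmf) \<Rightarrow> 's set \<Rightarrow> 's \<Rightarrow> ('s ext_state \<Rightarrow> 'a) \<Rightarrow> ennreal" where
  "expected_cover_time T V s0 \<pi> =
     (\<integral>\<^sup>+\<omega>. ennreal_of_enat (cover_time V (\<lambda>t. fst (\<omega> t))) \<partial>policy_paths T \<pi> (s0, V - {s0}))"

definition proper :: "('s \<Rightarrow> 'a \<Rightarrow> 's pmf) \<Rightarrow> 's set \<Rightarrow> ('s ext_state \<Rightarrow> 'a) \<Rightarrow> bool" where
  "proper T V \<pi> \<longleftrightarrow>
     (\<forall>x \<in> ext_states V. measure (policy_paths T \<pi> x) {\<omega>. \<exists>t. \<omega> t \<in> target_states} > 0)"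

section \<open>Policy iteration\<close>

definition is_value_function ::
    "('s::finite \<Rightarrow> 'a \<Rightarrow> 's pmf) \<Rightarrow> 's set \<Rightarrow> ('s ext_state \<Rightarrow> 'a) \<Rightarrow> ('s ext_state \<Rightarrow> real) \<Rightarrow> bool" where
  "is_value_function T V \<pi> v \<longleftrightarrow>
     v \<in> extensional (ext_states V) \<and>
     (\<forall>x \<in> ext_states V \<inter> target_states. v x = 0) \<and>
     (\<forall>(s, W) \<in> ext_states V - target_states.
        v (s, W) = -1 + (\<Sum>s'\<in>UNIV. pmf (product_transition T (s, W) (\<pi> (s, W))) (s', W - {s'}) * v (s', W - {s'})))"

text \<open>The linear system has exactly one solution if \<open>\<pi>\<close> is proper; otherwise
  \<open>value_function\<close> need not be meaningful.\<close>

definition value_function ::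
    "('s::finite \<Rightarrow> 'a \<Rightarrow> 's pmf) \<Rightarrow> 's set \<Rightarrow> ('s ext_state \<Rightarrow> 'a) \<Rightarrow> 's ext_state \<Rightarrow> real" where
  "value_function T V \<pi> = (THE v. is_value_function T V \<pi> v)"

definition action_value ::
    "('s::finite \<Rightarrow> 'a \<Rightarrow> 's pmf) \<Rightarrow> ('s ext_state \<Rightarrow> real) \<Rightarrow> 's ext_state \<Rightarrow> 'a \<Rightarrow> real" where
  "action_value T v x a =
     (case x of (s, W) \<Rightarrow>
        \<Sum>s'\<in>UNIV. pmf (product_transition T (s, W) a) (s', W - {s'}) *
          (product_reward (s, W) + v (s', W - {s'})))"

text \<open>An \<open>argmax\<close> operator, i.e. a fixed way of breaking ties at each extended state. If ties could
  be broken differently in every iteration, the iteration might alternate forever between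
  equally good policies and never meet its stopping criterion.\<close>

definition argmax_operator :: "('s ext_state \<Rightarrow> ('a \<Rightarrow> real) \<Rightarrow> 'a) \<Rightarrow> bool" where
  "argmax_operator am \<longleftrightarrow> (\<forall>x f. is_arg_max f (\<lambda>_. True) (am x f))"

definition improve ::
    "('s::finite \<Rightarrow> 'a \<Rightarrow> 's pmf) \<Rightarrow> 's set \<Rightarrow> ('s ext_state \<Rightarrow> ('a \<Rightarrow> real) \<Rightarrow> 'a) \<Rightarrow>
     ('s ext_state \<Rightarrow> 'a) \<Rightarrow> ('s ext_state \<Rightarrow> 'a)" where
  "improve T V am \<pi> = (\<lambda>x \<in> ext_states V. am x (action_value T (value_function T V \<pi>) x))"

definition policy_iteration_returns ::
    "('s::finite \<Rightarrow> 'a \<Rightarrow> 's pmf) \<Rightarrow> 's set \<Rightarrow> ('s ext_state \<Rightarrow> ('a \<Rightarrow> real) \<Rightarrow> 'a) \<Rightarrow>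
     ('s ext_state \<Rightarrow> 'a) \<Rightarrow> ('s ext_state \<Rightarrow> 'a) \<Rightarrow> bool" where
  "policy_iteration_returns T V am \<pi>0 \<pi>' \<longleftrightarrow>
     (\<exists>n. \<pi>' = (improve T V am ^^ n) \<pi>0 \<and> improve T V am \<pi>' = \<pi>')"

end

theory Submission
  imports Defs
begin

text \<open>A policy from which the targets are reachable everywhere has exactly one value function: by the
  maximum principle the homogeneous linear system has only the zero solution, and the system is
  square. If \<open>v\<close> is this value function, the improved policy gains at least 1 in
  expected \<open>v\<close> per step away from the targets. As \<open>v\<close> is bounded, this forces the
  targets to be reachable under the improved policy too, and the maximum principle then shows that
  values do not decrease. There are finitely many policies, so some policy recurs; all values in
  between are then equal, and with fixed tie-breaking the iteration is stationary from the next step on.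

  The value function of a stationary policy satisfies the Bellman inequality for every action. With
  \<open>W\<^sub>t\<close> the remaining set at time \<open>t\<close>, the expected cover time is
  \<open>\<Sum>t. P (W\<^sub>t \<noteq> {})\<close>, so it depends only on the laws of the single states of the
  chain. Iterating the inequality along these laws bounds the expected cover time of any policy from
  below by minus the value; for the stationary policy itself equality holds in the Bellman
  inequality, and since the value is nonpositive the iteration also gives the upper bound.\<close>

section \<open>Laws of single states and single steps of a chain\<close>

primrec law :: "('x \<Rightarrow> 'x pmf) \<Rightarrow> 'x \<Rightarrow> nat \<Rightarrow> 'x pmf" where
  "law K x 0 = return_pmf x"
| "law K x (Suc t) = bind_pmf (law K x t) K"

context
  fixes K :: "'x::countable \<Rightarrow> 'x pmf" and x :: 'x
begin

interpretation Ionescu_Tulcea "chain_kernel K x" "\<lambda>_. count_space UNIV"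
  by (rule Ionescu_Tulcea_chain_kernel)

text \<open>The law of the first \<open>n\<close> states of the trajectory. The composition starts
  from the empty history, and \<open>\<lambda>_. undefined\<close> is the only point of the empty
  product.\<close>

abbreviation (input) "initial n \<equiv> C 0 n (\<lambda>_. undefined)"

lemma distr_path_measure_initial:
  "distr (path_measure K x) (PiM {0..<n} (\<lambda>_. count_space UNIV)) (\<lambda>\<omega>. restrict \<omega> {0..<n}) = initial n"
proof -
  \<comment> \<open>\<open>up_to\<close> is the least bound of the index set. Here it is
    \<open>n\<close> itself, so the restriction built into \<open>CI\<close> changes
    nothing.\<close>
  have "up_to {0..<n} = n"
  proof (rule antisym)
    show "n \<le> up_to {0..<n}"
      using up_to[of "{0..<n}"] by auto
  qed (simp add: up_to_iff_Ico)
  then have "CI {0..<n} = distr (initial n) (PiM {0..<n} (\<lambda>_. count_space UNIV)) (\<lambda>\<omega>. restrict \<omega> {0..<n})"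
    by (simp add: CI_def)
  also have "\<dots> = initial n"
    using distr_C[of n n "\<lambda>_. undefined" 0] by simp
  finally show ?thesis
    by (simp add: distr_path_measure)
qed

lemma nn_integral_path_measure_initial:
  assumes "f \<in> borel_measurable (PiM {0..<n} (\<lambda>_. count_space UNIV))"
  shows "(\<integral>\<^sup>+\<omega>. f (restrict \<omega> {0..<n}) \<partial>path_measure K x) = (\<integral>\<^sup>+\<omega>. f \<omega> \<partial>initial n)"
  unfolding distr_path_measure_initial[symmetric] using assms
  by (subst nn_integral_distr)
    (auto simp: measurable_cong_sets[OF sets_path_measure refl] intro!: measurable_restrict)

lemma nn_integral_initial_Suc:
  assumes "f \<in> borel_measurable (PiM {0..<Suc n} (\<lambda>_. count_space UNIV))"
  shows "(\<integral>\<^sup>+\<omega>. f \<omega> \<partial>initial (Suc n)) = (\<integral>\<^sup>+\<omega>. \<integral>\<^sup>+y. f (fun_upd \<omega> n y) \<partial>chain_kernel K x n \<omega> \<partial>initial n)"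
proof -
  have "eP n \<in> measurable (initial n) (subprob_algebra (PiM {0..<Suc n} (\<lambda>_. count_space UNIV)))"
    by (subst measurable_cong_sets[OF sets_C refl]) (auto intro: measurable_eP)
  then have "(\<integral>\<^sup>+\<omega>. f \<omega> \<partial>initial (Suc n)) = (\<integral>\<^sup>+\<omega>. \<integral>\<^sup>+\<omega>'. f \<omega>' \<partial>eP n \<omega> \<partial>initial n)"
    using assms by (simp add: nn_integral_bind)
  also have "\<dots> = (\<integral>\<^sup>+\<omega>. \<integral>\<^sup>+y. f (fun_upd \<omega> n y) \<partial>chain_kernel K x n \<omega> \<partial>initial n)"
    using assms by (intro nn_integral_cong nn_integral_eP) (auto simp: space_C)
  finally show ?thesis .
qed

lemma chain_kernel_simps:
  "chain_kernel K x 0 \<omega> = measure_pmf (return_pmf x)"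
  "chain_kernel K x (Suc n) \<omega> = measure_pmf (K (\<omega> n))"
  by (simp_all add: chain_kernel_def)

text \<open>The coordinates of \<open>initial (Suc n)\<close> run from 0 to \<open>n\<close>, hence
  the shift. The induction generalises \<open>f\<close> because its step applies the hypothesis to
  the average of \<open>f\<close> under \<open>K\<close>.\<close>

lemma nn_integral_initial_last:
  fixes f :: "'x \<Rightarrow> ennreal"
  shows "(\<integral>\<^sup>+\<omega>. f (\<omega> n) \<partial>initial (Suc n)) = (\<integral>\<^sup>+y. f y \<partial>law K x n)"
proof (induction n arbitrary: f)
  case 0
  have "(\<lambda>\<omega>. f (\<omega> 0)) \<in> borel_measurable (PiM {0..<Suc 0} (\<lambda>_. count_space UNIV))"
    by measurable
  from nn_integral_initial_Suc[OF this] show ?case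
    by (simp add: chain_kernel_simps prob_space.emeasure_space_1[OF prob_space_C] del: C.simps)
next
  case (Suc n)
  have "(\<lambda>\<omega>. f (\<omega> (Suc n))) \<in> borel_measurable (PiM {0..<Suc (Suc n)} (\<lambda>_. count_space UNIV))"
    by measurable
  from nn_integral_initial_Suc[OF this] show ?case
    by (simp add: chain_kernel_simps Suc[of "\<lambda>y. \<integral>\<^sup>+z. f z \<partial>K y"] del: C.simps)
qed

end

text \<open>Single-time laws and almost sure properties of trajectories are all read off from this
  joint law of two consecutive states.\<close>

lemma nn_integral_path_measure_step:
  fixes K :: "'x::countable \<Rightarrow> 'x pmf" and f :: "'x \<Rightarrow> 'x \<Rightarrow> ennreal"
  shows "(\<integral>\<^sup>+\<omega>. f (\<omega> n) (\<omega> (Suc n)) \<partial>path_measure K x) = (\<integral>\<^sup>+y. \<integral>\<^sup>+z. f y z \<partial>K y \<partial>law K x n)"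
proof -
  have *: "(\<lambda>\<omega>. f (\<omega> n) (\<omega> (Suc n))) \<in> borel_measurable (PiM {0..<Suc (Suc n)} (\<lambda>_. count_space UNIV))"
    by measurable
  from nn_integral_path_measure_initial[OF this] nn_integral_initial_Suc[OF *]
    nn_integral_initial_last[where f = "\<lambda>y. \<integral>\<^sup>+z. f y z \<partial>K y"]
  show ?thesis
    by (simp add: chain_kernel_simps del: Ionescu_Tulcea.C.simps)
qed

lemma measurable_path_measure_component:
  "(\<lambda>\<omega>. \<omega> n) \<in> measurable (path_measure K x) (count_space UNIV)"
  by (subst measurable_cong_sets[OF sets_path_measure refl]) (rule measurable_component_singleton, simp)

lemma measurable_path_measure_step:
  fixes f :: "'x::countable \<Rightarrow> 'x \<Rightarrow> ennreal"
  shows "(\<lambda>\<omega>. f (\<omega> m) (\<omega> n)) \<in> borel_measurable (path_measure K x)"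
  by (subst measurable_cong_sets[OF sets_path_measure refl]) measurable

lemma space_path_measure: "space (path_measure K x) = UNIV"
  using sets_eq_imp_space_eq[OF sets_path_measure[of K x]] by (simp add: space_PiM)

lemma nn_integral_path_measure_at:
  fixes K :: "'x::countable \<Rightarrow> 'x pmf"
  shows "(\<integral>\<^sup>+\<omega>. f (\<omega> t) \<partial>path_measure K x) = (\<integral>\<^sup>+y. f y \<partial>law K x t)"
  using nn_integral_path_measure_step[where f = "\<lambda>y z. f y" and n = t and x = x and K = K] by simp

lemma emeasure_path_measure_at:
  fixes K :: "'x::countable \<Rightarrow> 'x pmf"
  shows "emeasure (path_measure K x) {\<omega>. \<omega> t \<in> A} = emeasure (law K x t) A"
proof -
  have "{\<omega>. \<omega> t \<in> A} \<in> sets (path_measure K x)"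
    using measurable_sets[OF measurable_path_measure_component, of A t K x]
    by (simp add: vimage_def space_path_measure)
  then have "emeasure (path_measure K x) {\<omega>. \<omega> t \<in> A} = (\<integral>\<^sup>+\<omega>. indicator A (\<omega> t) \<partial>path_measure K x)"
    by (simp flip: nn_integral_indicator add: indicator_def)
  also have "\<dots> = emeasure (law K x t) A"
    using nn_integral_path_measure_step[where f = "\<lambda>y z. indicator A y" and n = t and x = x and K = K] by simp
  finally show ?thesis .
qed

lemma AE_path_measure:
  fixes K :: "'x::countable \<Rightarrow> 'x pmf"
  shows "AE \<omega> in path_measure K x. \<omega> 0 = x \<and> (\<forall>t. \<omega> (Suc t) \<in> set_pmf (K (\<omega> t)))"
proof -
  have "AE \<omega> in path_measure K x. \<omega> (Suc t) \<in> set_pmf (K (\<omega> t))" for t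
  proof -
    \<comment> \<open>\<open>?f\<close> indicates a transition that \<open>K\<close> does not allow.
      By the step formula its integral is 0 at each time, and there are only countably many
      times.\<close>
    let ?f = "\<lambda>y z. indicator (- set_pmf (K y)) z :: ennreal"
    have "(\<integral>\<^sup>+\<omega>. ?f (\<omega> t) (\<omega> (Suc t)) \<partial>path_measure K x) = 0"
      by (subst nn_integral_path_measure_step)
        (simp add: nn_integral_0_iff_AE AE_measure_pmf_iff measure_pmf.emeasure_eq_measure measure_pmf_zero_iff)
    moreover have "(\<lambda>\<omega>. ?f (\<omega> t) (\<omega> (Suc t))) \<in> borel_measurable (path_measure K x)"
      by (rule measurable_path_measure_step)
    ultimately show ?thesis
      by (simp add: nn_integral_0_iff_AE indicator_eq_0_iff)
  qed
  moreover have "AE \<omega> in path_measure K x. \<omega> 0 = x"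
  proof -
    have "(\<integral>\<^sup>+\<omega>. indicator (- {x}) (\<omega> 0) \<partial>path_measure K x) = 0"
      using nn_integral_path_measure_step[where f = "\<lambda>y z. indicator (- {x}) y" and n = 0 and x = x and K = K]
      by (simp add: nn_integral_0_iff_AE AE_measure_pmf_iff)
    moreover have "(\<lambda>\<omega>. indicator (- {x}) (\<omega> 0) :: ennreal) \<in> borel_measurable (path_measure K x)"
      by (rule measurable_path_measure_step)
    ultimately show ?thesis
      by (simp add: nn_integral_0_iff_AE indicator_eq_0_iff)
  qed
  ultimately show ?thesis
    by (simp add: AE_all_countable)
qed


section \<open>Reachability\<close>

lemma law_subset:
  assumes "\<And>y. y \<in> S \<Longrightarrow> set_pmf (K y) \<subseteq> S" "x \<in> S"
  shows "set_pmf (law K x t) \<subseteq> S"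
  using assms by (induction t) auto

text \<open>Positive probability of hitting \<open>D\<close>, phrased through supports so that the
  arguments below can follow possible transitions without the path measure.\<close>

definition reaches :: "('x \<Rightarrow> 'x pmf) \<Rightarrow> 'x set \<Rightarrow> 'x \<Rightarrow> bool" where
  "reaches K D x \<longleftrightarrow> (\<exists>t. set_pmf (law K x t) \<inter> D \<noteq> {})"

text \<open>If no law charges \<open>D\<close>, then hitting \<open>D\<close> is a countable union
  of null events, one for each time.\<close>

lemma reaches_if_measure_pos:
  fixes K :: "'x::countable \<Rightarrow> 'x pmf"
  assumes "measure (path_measure K x) {\<omega>. \<exists>t. \<omega> t \<in> D} > 0"
  shows "reaches K D x"
proof (rule ccontr)
  assume "\<not> reaches K D x"
  then have "emeasure (path_measure K x) {\<omega>. \<omega> t \<in> D} = 0" for t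
    unfolding emeasure_path_measure_at
    by (auto simp: reaches_def measure_pmf.emeasure_eq_measure measure_pmf_zero_iff)
  moreover have "{\<omega>. \<omega> t \<in> D} \<in> sets (path_measure K x)" for t
    using measurable_sets[OF measurable_path_measure_component, of D t K x]
    by (simp add: vimage_def space_path_measure)
  ultimately have "emeasure (path_measure K x) (\<Union>t. {\<omega>. \<omega> t \<in> D}) = 0"
    by (intro emeasure_UN_eq_0) auto
  then have "emeasure (path_measure K x) {\<omega>. \<exists>t. \<omega> t \<in> D} = 0"
    by (simp add: Collect_ex_eq)
  with assms show False
    by (simp add: measure_def)
qed

section \<open>Expectations over finite state spaces\<close>

lemma integrable_finite_pmf [simp]:
  fixes p :: "'x::finite pmf" and f :: "'x \<Rightarrow> real"
  shows "integrable p f"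
  by (rule integrable_measure_pmf_finite) simp

lemma expectation_mono:
  fixes p :: "'x::finite pmf" and f g :: "'x \<Rightarrow> real"
  assumes "\<And>y. y \<in> set_pmf p \<Longrightarrow> f y \<le> g y"
  shows "measure_pmf.expectation p f \<le> measure_pmf.expectation p g"
  using assms by (intro integral_mono_AE) (auto simp: AE_measure_pmf_iff)

lemma expectation_bind:
  fixes p :: "'x::finite pmf" and K :: "'x \<Rightarrow> 'y::finite pmf" and f :: "'y \<Rightarrow> real"
  shows "measure_pmf.expectation (bind_pmf p K) f =
    measure_pmf.expectation p (\<lambda>y. measure_pmf.expectation (K y) f)"
proof -
  have "measure_pmf.expectation (bind_pmf p K) f = (\<Sum>y\<in>UNIV. pmf p y *\<^sub>R measure_pmf.expectation (K y) f)"
    by (rule pmf_expectation_bind) auto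
  also have "\<dots> = measure_pmf.expectation p (\<lambda>y. measure_pmf.expectation (K y) f)"
    by (rule integral_measure_pmf[symmetric]) auto
  finally show ?thesis .
qed

text \<open>\<open>M - f\<close> is nonnegative on the support and has nonpositive expectation, so
  it vanishes almost surely.\<close>

lemma eq_on_set_pmf_if_le_expectation:
  fixes p :: "'x::finite pmf" and f :: "'x \<Rightarrow> real"
  assumes le: "\<And>y. y \<in> set_pmf p \<Longrightarrow> f y \<le> M" and M: "M \<le> measure_pmf.expectation p f"
    and y: "y \<in> set_pmf p"
  shows "f y = M"
proof -
  have nonneg: "AE z in p. 0 \<le> M - f z"
    using le by (auto simp: AE_measure_pmf_iff)
  have "measure_pmf.expectation p (\<lambda>z. M - f z) \<le> 0"
    using M by simp
  with integral_nonneg_AE[OF nonneg] have "measure_pmf.expectation p (\<lambda>z. M - f z) = 0"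
    by linarith
  then have "AE z in p. M - f z = 0"
    by (subst (asm) integral_nonneg_eq_0_iff_AE[OF _ nonneg]) auto
  with y show ?thesis
    by (auto simp: AE_measure_pmf_iff)
qed

section \<open>Maximum principle, linear systems and accumulated costs\<close>

locale closed_chain =
  fixes K :: "'x::finite \<Rightarrow> 'x pmf" and S D :: "'x set"
  assumes closed: "\<And>x. x \<in> S \<Longrightarrow> set_pmf (K x) \<subseteq> S"
begin

text \<open>Maximum principle: a positive maximum cannot lie in \<open>D\<close>, so the inequality
  applies there and forces every successor to be maximal as well. The maximum thus spreads to all
  reachable states, one of which lies in \<open>D\<close>.\<close>

lemma subharmonic_nonpos:
  fixes f :: "'x \<Rightarrow> real"
  assumes D: "\<And>x. x \<in> S \<inter> D \<Longrightarrow> f x \<le> 0"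
    and le: "\<And>x. x \<in> S - D \<Longrightarrow> f x \<le> measure_pmf.expectation (K x) f"
    and reaches: "\<And>x. x \<in> S \<Longrightarrow> reaches K D x"
    and "x \<in> S"
  shows "f x \<le> 0"
proof (rule ccontr)
  assume "\<not> f x \<le> 0"
  define M where "M = Max (f ` S)"
  have le_M: "f y \<le> M" if "y \<in> S" for y
    using that by (simp add: M_def)
  have "M \<in> f ` S"
    unfolding M_def using \<open>x \<in> S\<close> by (intro Max_in) auto
  then obtain z where z: "z \<in> S" "f z = M"
    by auto
  have "M > 0"
    using le_M[OF \<open>x \<in> S\<close>] \<open>\<not> f x \<le> 0\<close> by linarith
  have *: "y \<in> S \<and> f y = M" if "y \<in> set_pmf (law K z t)" for y t
    using that
  proof (induction t arbitrary: y)
    case 0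
    with z show ?case by simp
  next
    case (Suc t)
    then obtain y' where y': "y' \<in> set_pmf (law K z t)" "y \<in> set_pmf (K y')"
      by auto
    with Suc.IH have "y' \<in> S" "f y' = M"
      by auto
    moreover from this D[of y'] \<open>M > 0\<close> have "y' \<in> S - D"
      by force
    ultimately show ?case
      using eq_on_set_pmf_if_le_expectation[of "K y'" f M y] le[of y'] le_M closed[of y'] y' by auto
  qed
  obtain t y where "y \<in> set_pmf (law K z t)" "y \<in> D"
    using reaches[OF \<open>z \<in> S\<close>] by (auto simp: reaches_def)
  with *[of y t] D[of y] \<open>M > 0\<close> show False
    by auto
qed

text \<open>Otherwise the set \<open>R\<close> of reachable states is closed and avoids
  \<open>D\<close>. At a maximiser of \<open>f\<close> over \<open>R\<close>, no step can gain 1 in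
  expectation.\<close>

lemma reaches_if_strictly_subharmonic:
  fixes f :: "'x \<Rightarrow> real"
  assumes le: "\<And>x. x \<in> S - D \<Longrightarrow> f x + 1 \<le> measure_pmf.expectation (K x) f"
    and "x \<in> S"
  shows "reaches K D x"
proof (rule ccontr)
  assume not: "\<not> reaches K D x"
  define R where "R = (\<Union>t. set_pmf (law K x t))"
  have R: "R \<subseteq> S - D"
    using law_subset[of S K x] closed \<open>x \<in> S\<close> not by (auto simp: R_def reaches_def)
  have "x \<in> R"
    by (auto simp: R_def intro!: exI[of _ 0])
  have "set_pmf (K y) \<subseteq> R" if "y \<in> R" for y
  proof -
    from that obtain t where "y \<in> set_pmf (law K x t)"
      by (auto simp: R_def)
    then have "set_pmf (K y) \<subseteq> set_pmf (law K x (Suc t))"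
      by auto
    then show ?thesis
      unfolding R_def by blast
  qed
  moreover have "Max (f ` R) \<in> f ` R"
    using \<open>x \<in> R\<close> by (intro Max_in) auto
  then obtain y where y: "y \<in> R" "f y = Max (f ` R)"
    by auto
  ultimately have "measure_pmf.expectation (K y) f \<le> measure_pmf.expectation (K y) (\<lambda>_. f y)"
    by (intro expectation_mono) (auto intro!: Max_ge)
  with le[of y] y R show False
    by auto
qed

lemma poisson_equation_solvable:
  fixes c :: "'x \<Rightarrow> real"
  assumes reaches: "\<And>x. x \<in> S \<Longrightarrow> reaches K D x"
  shows "\<exists>u. (\<forall>x\<in>S - D. u x = c x + measure_pmf.expectation (K x) u) \<and> (\<forall>x. x \<notin> S - D \<longrightarrow> u x = 0)"
proof -
  \<comment> \<open>Outside \<open>S - D\<close> the operator is the identity, which encodes the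
    condition \<open>u x = 0\<close> there and keeps the system square.\<close>
  define g where "g u = (\<chi> x. u $ x - (if x \<in> S - D then measure_pmf.expectation (K x) (\<lambda>y. u $ y) else 0))"
    for u :: "real ^ 'x"
  have [simp]: "($) (u + u') = (\<lambda>y. u $ y + u' $ y)" "($) (r *\<^sub>R u) = (\<lambda>y. r * u $ y)"
    for u u' :: "real ^ 'x" and r
    by auto
  have "linear g"
    by (rule linearI) (auto simp: g_def vec_eq_iff algebra_simps)
  moreover have "u = 0" if "g u = 0" for u
  proof -
    have harmonic: "u $ x = measure_pmf.expectation (K x) (\<lambda>y. u $ y)" if "x \<in> S - D" for x
      using that arg_cong[OF \<open>g u = 0\<close>, of "\<lambda>u. u $ x"] by (simp add: g_def)
    have zero: "u $ x = 0" if "x \<notin> S - D" for x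
      using that arg_cong[OF \<open>g u = 0\<close>, of "\<lambda>u. u $ x"] by (auto simp: g_def)
    have "u $ x = 0" for x
    proof (cases "x \<in> S")
      case True
      \<comment> \<open>A kernel vector is harmonic on \<open>S - D\<close> and zero elsewhere, so
        the maximum principle bounds both it and its negative.\<close>
      have "u $ x \<le> 0"
        by (rule subharmonic_nonpos[of "\<lambda>x. u $ x"]) (use reaches True zero eq_refl[OF harmonic] in auto)
      moreover have "- u $ x \<le> 0"
        by (rule subharmonic_nonpos[of "\<lambda>x. - u $ x"]) (use reaches True zero eq_refl[OF harmonic[symmetric]] in auto)
      ultimately show ?thesis
        by simp
    qed (use zero in simp)
    then show ?thesis
      by (simp add: vec_eq_iff)
  qed
  ultimately have "surj g"
    by (intro linear_injective_imp_surjective) (auto simp: linear_injective_0)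
  then obtain u where "g u = (\<chi> x. if x \<in> S - D then c x else 0)"
    by (metis surjD)
  then have u: "g u $ x = (if x \<in> S - D then c x else 0)" for x
    by simp
  show ?thesis
  proof (intro exI conjI ballI allI impI)
    show "u $ x = c x + measure_pmf.expectation (K x) (\<lambda>x. u $ x)" if "x \<in> S - D" for x
      using u[of x] that by (simp add: g_def)
    show "u $ x = 0" if "x \<notin> S - D" for x
      using u[of x] that by (auto simp: g_def)
  qed
qed

lemma le_accumulated_cost:
  fixes w c :: "'x \<Rightarrow> real"
  assumes le: "\<And>y. y \<in> S \<Longrightarrow> w y \<le> c y + measure_pmf.expectation (K y) w" and "x \<in> S"
  shows "w x \<le> (\<Sum>t<N. measure_pmf.expectation (law K x t) c) + measure_pmf.expectation (law K x N) w"
proof (induction N)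
  case (Suc N)
  have "measure_pmf.expectation (law K x N) w
    \<le> measure_pmf.expectation (law K x N) (\<lambda>y. c y + measure_pmf.expectation (K y) w)"
    using law_subset[of S K x N] closed \<open>x \<in> S\<close> le by (intro expectation_mono) blast
  also have "\<dots> = measure_pmf.expectation (law K x N) c + measure_pmf.expectation (law K x (Suc N)) w"
    by (simp add: expectation_bind)
  finally show ?case
    using Suc by simp
qed simp

text \<open>After \<open>N\<close> steps the remainder, the expectation of \<open>w\<close>, is at
  most \<open>M\<close> times the probability of \<open>B\<close> at time \<open>N\<close>, because
  \<open>w\<close> is nonpositive on \<open>S - B\<close>. If the total cost is finite, this tends
  to 0.\<close>

lemma le_total_cost:
  fixes w :: "'x \<Rightarrow> real"
  assumes le: "\<And>y. y \<in> S \<Longrightarrow> w y \<le> indicator B y + measure_pmf.expectation (K y) w"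
    and B: "\<And>y. y \<in> S - B \<Longrightarrow> w y \<le> 0" and "x \<in> S"
  shows "ennreal (w x) \<le> (\<Sum>t. emeasure (law K x t) B)"
proof (cases "(\<Sum>t. emeasure (law K x t) B) = top")
  case False
  define f where "f t = measure (law K x t) B" for t
  have eq: "(\<Sum>t. emeasure (law K x t) B) = (\<Sum>t. ennreal (f t))"
    by (simp add: f_def measure_pmf.emeasure_eq_measure)
  have f: "f t \<ge> 0" for t
    by (simp add: f_def)
  have sm: "summable f"
    using False f by (intro summable_suminf_not_top) (auto simp: eq)
  define M where "M = Max (insert 0 (w ` S))"
  have "M \<ge> 0" and M: "\<And>y. y \<in> S \<Longrightarrow> w y \<le> M"
    by (auto simp: M_def)
  have "w x \<le> (\<Sum>t<N. f t) + M * f N" for N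
  proof -
    have "measure_pmf.expectation (law K x N) w \<le> measure_pmf.expectation (law K x N) (\<lambda>y. M * indicator B y)"
    proof (rule expectation_mono)
      fix y assume "y \<in> set_pmf (law K x N)"
      then have "y \<in> S"
        using law_subset[of S K x N] closed \<open>x \<in> S\<close> by blast
      then show "w y \<le> M * indicator B y"
        using M[of y] B[of y] by (auto simp: indicator_def)
    qed
    then show ?thesis
      using le_accumulated_cost[OF le \<open>x \<in> S\<close>, of N] by (simp add: f_def)
  qed
  moreover have "(\<lambda>N. (\<Sum>t<N. f t) + M * f N) \<longlonglongrightarrow> suminf f + M * 0"
    using sm by (intro tendsto_intros summable_LIMSEQ summable_LIMSEQ_zero)
  ultimately have "w x \<le> suminf f"
    by (intro LIMSEQ_le_const[of _ "suminf f"]) auto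
  then show ?thesis
    using sm f by (simp add: eq suminf_ennreal2 ennreal_leI)
qed simp

lemma total_cost_le:
  fixes w :: "'x \<Rightarrow> real"
  assumes le: "\<And>y. y \<in> S \<Longrightarrow> indicator B y + measure_pmf.expectation (K y) w \<le> w y"
    and nonneg: "\<And>y. y \<in> S \<Longrightarrow> 0 \<le> w y" and "x \<in> S"
  shows "(\<Sum>t. emeasure (law K x t) B) \<le> ennreal (w x)"
proof -
  define f where "f t = measure (law K x t) B" for t
  have f: "f t \<ge> 0" for t
    by (simp add: f_def)
  have *: "(\<Sum>t<N. f t) \<le> w x" for N
  proof -
    \<comment> \<open>Negating \<open>w\<close> and the cost turns the hypothesis into that of
      \<open>le_accumulated_cost\<close>; the remainder has a favourable sign and is
      dropped.\<close>
    have "- w y \<le> - indicator B y + measure_pmf.expectation (K y) (\<lambda>y. - w y)" if "y \<in> S" for y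
      using le[OF that] by simp
    from le_accumulated_cost[of "\<lambda>y. - w y" "\<lambda>y. - indicator B y", OF this \<open>x \<in> S\<close>, of N]
    have "(\<Sum>t<N. f t) + measure_pmf.expectation (law K x N) w \<le> w x"
      by (simp add: f_def sum_negf)
    moreover have "0 \<le> measure_pmf.expectation (law K x N) w"
      using nonneg law_subset[of S K x N] closed \<open>x \<in> S\<close>
      by (intro integral_nonneg_AE) (auto simp: AE_measure_pmf_iff)
    ultimately show ?thesis
      by linarith
  qed
  have "summable f"
    using f * by (rule summableI_nonneg_bounded)
  moreover from this have "suminf f \<le> w x"
    using * by (rule suminf_le_const)
  ultimately show ?thesis
    using f by (simp add: measure_pmf.emeasure_eq_measure flip: f_def) (simp add: suminf_ennreal2 ennreal_leI)
qed

end

section \<open>Cover times and remaining sets\<close>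

lemma INF_enat_le_iff: "(INF t\<in>{t. P t}. enat t) \<le> enat n \<longleftrightarrow> (\<exists>t\<le>n. P t)"
proof
  assume le: "(INF t\<in>{t. P t}. enat t) \<le> enat n"
  show "\<exists>t\<le>n. P t"
  proof (rule ccontr)
    assume "\<not> (\<exists>t\<le>n. P t)"
    then have "enat (Suc n) \<le> (INF t\<in>{t. P t}. enat t)"
      by (intro INF_greatest) (auto simp: not_le Suc_le_eq)
    with le have "enat (Suc n) \<le> enat n"
      by (rule order_trans[rotated])
    then show False
      by simp
  qed
next
  assume "\<exists>t\<le>n. P t"
  then show "(INF t\<in>{t. P t}. enat t) \<le> enat n"
    by (auto intro!: INF_lower2)
qed

lemma cover_time_le_iff: "cover_time V X \<le> enat n \<longleftrightarrow> V \<subseteq> X ` {..n}"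
proof -
  have "cover_time V X \<le> enat n \<longleftrightarrow> (\<exists>t\<le>n. \<forall>s\<in>V. \<exists>i\<le>t. X i = s)"
    by (simp add: cover_time_def hitting_time_def INF_enat_le_iff)
  also have "\<dots> \<longleftrightarrow> (\<forall>s\<in>V. \<exists>i\<le>n. X i = s)"
    by (meson order_refl order_trans)
  also have "\<dots> \<longleftrightarrow> V \<subseteq> X ` {..n}"
    by (auto simp: subset_iff image_iff)
  finally show ?thesis .
qed

text \<open>Counts the times below \<open>c\<close>. For \<open>c = \<infinity>\<close> every term
  is 1 and the partial sums diverge.\<close>

lemma ennreal_of_enat_eq_suminf:
  "ennreal_of_enat c = (\<Sum>t. if enat t < c then 1 else 0)"
proof -
  have "(\<lambda>t. if enat t < c then 1 else 0 :: ennreal) sums ennreal_of_enat c"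
    using sums_If_finite[of "\<lambda>t. enat t < c" "\<lambda>_. 1 :: ennreal"]
    by (cases c) (simp_all add: sums_def of_nat_tendsto_top_ennreal)
  then show ?thesis
    by (simp add: sums_iff)
qed

abbreviation policy_kernel ::
    "('s \<Rightarrow> 'a \<Rightarrow> 's pmf) \<Rightarrow> ('s ext_state \<Rightarrow> 'a) \<Rightarrow> 's ext_state \<Rightarrow> 's ext_state pmf" where
  "policy_kernel T \<pi> \<equiv> \<lambda>x. product_transition T x (\<pi> x)"

lemma set_pmf_product_transition:
  "set_pmf (product_transition T (s, W) a) = (\<lambda>s'. (s', W - {s'})) ` set_pmf (T s a)"
  by (simp add: product_transition_def)

text \<open>Each step removes the location it arrives at. The location at time 0 is never arrived
  at, so it has to be missing from the initial remaining set.\<close>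

lemma remaining_eq:
  assumes "\<omega> 0 = (s0, V - {s0})" "\<And>t. \<omega> (Suc t) \<in> set_pmf (policy_kernel T \<pi> (\<omega> t))"
  shows "snd (\<omega> t) = V - (\<lambda>t. fst (\<omega> t)) ` {..t}"
proof (induction t)
  case (Suc t)
  have "snd (\<omega> (Suc t)) = snd (\<omega> t) - {fst (\<omega> (Suc t))}"
    using assms(2)[of t] by (cases "\<omega> t") (auto simp: set_pmf_product_transition)
  with Suc show ?case
    by (auto simp: atMost_Suc)
qed (simp add: assms(1))

lemma expected_cover_time_eq_suminf:
  fixes T :: "'s::finite \<Rightarrow> 'a \<Rightarrow> 's pmf"
  shows "expected_cover_time T V s0 \<pi> =
    (\<Sum>t. emeasure (law (policy_kernel T \<pi>) (s0, V - {s0}) t) {y. snd y \<noteq> {}})"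
proof -
  let ?B = "{y :: 's ext_state. snd y \<noteq> {}}" and ?P = "policy_paths T \<pi> (s0, V - {s0})"
  have "AE \<omega> in ?P. \<omega> 0 = (s0, V - {s0}) \<and> (\<forall>t. \<omega> (Suc t) \<in> set_pmf (policy_kernel T \<pi> (\<omega> t)))"
    unfolding policy_paths_def by (rule AE_path_measure)
  then have "AE \<omega> in ?P. ennreal_of_enat (cover_time V (\<lambda>t. fst (\<omega> t))) = (\<Sum>t. indicator ?B (\<omega> t))"
  proof eventually_elim
    case (elim \<omega>)
    \<comment> \<open>The cover time exceeds \<open>t\<close> exactly when some state of
      \<open>V\<close> remains at time \<open>t\<close>.\<close>
    have "enat t < cover_time V (\<lambda>t. fst (\<omega> t)) \<longleftrightarrow> \<omega> t \<in> ?B" for t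
      using remaining_eq[of \<omega> s0 V T \<pi> t] elim by (auto simp: cover_time_le_iff simp flip: not_le)
    then show ?case
      by (simp add: ennreal_of_enat_eq_suminf indicator_def of_bool_def)
  qed
  then have "expected_cover_time T V s0 \<pi> = (\<integral>\<^sup>+\<omega>. (\<Sum>t. indicator ?B (\<omega> t)) \<partial>?P)"
    unfolding expected_cover_time_def by (rule nn_integral_cong_AE)
  also have "\<dots> = (\<Sum>t. \<integral>\<^sup>+\<omega>. indicator ?B (\<omega> t) \<partial>?P)"
    unfolding policy_paths_def
    by (rule nn_integral_suminf) (rule measurable_path_measure_step)
  also have "\<dots> = (\<Sum>t. emeasure (law (policy_kernel T \<pi>) (s0, V - {s0}) t) ?B)"
    by (simp add: policy_paths_def nn_integral_path_measure_at)
  finally show ?thesis .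
qed


section \<open>Value functions on the product MDP\<close>

lemma set_pmf_product_transition_subset:
  assumes "x \<in> ext_states V"
  shows "set_pmf (product_transition T x a) \<subseteq> ext_states V"
  using assms by (cases x) (auto simp: ext_states_def set_pmf_product_transition)

text \<open>The next location determines the next remaining set, so summing over locations already
  gives the full expectation.\<close>

lemma sum_product_transition:
  fixes T :: "'s::finite \<Rightarrow> 'a \<Rightarrow> 's pmf" and f :: "'s ext_state \<Rightarrow> real"
  shows "(\<Sum>s'\<in>UNIV. pmf (product_transition T (s, W) a) (s', W - {s'}) * f (s', W - {s'})) =
    measure_pmf.expectation (product_transition T (s, W) a) f"
proof -
  have "measure_pmf.expectation (product_transition T (s, W) a) f =
      measure_pmf.expectation (T s a) (\<lambda>s'. f (s', W - {s'}))"
    by (simp add: product_transition_def)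
  also have "\<dots> = (\<Sum>s'\<in>UNIV. pmf (T s a) s' *\<^sub>R f (s', W - {s'}))"
    by (rule integral_measure_pmf) auto
  finally show ?thesis
    by (simp add: pmf_product_transition)
qed

text \<open>The reward depends only on the current state and the probabilities sum to 1, so it
  leaves the sum.\<close>

lemma action_value_eq:
  fixes T :: "'s::finite \<Rightarrow> 'a \<Rightarrow> 's pmf"
  shows "action_value T v x a = product_reward x + measure_pmf.expectation (product_transition T x a) v"
proof (cases x)
  case (Pair s W)
  have "action_value T v x a =
      measure_pmf.expectation (product_transition T (s, W) a) (\<lambda>y. product_reward (s, W) + v y)"
    unfolding Pair action_value_def case_prod_conv by (rule sum_product_transition)
  then show ?thesis
    by (simp add: Pair)
qed

lemma is_value_function_iff:
  fixes T :: "'s::finite \<Rightarrow> 'a \<Rightarrow> 's pmf"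
  shows "is_value_function T V \<pi> v \<longleftrightarrow>
    v \<in> extensional (ext_states V) \<and>
    (\<forall>x \<in> ext_states V \<inter> target_states. v x = 0) \<and>
    (\<forall>x \<in> ext_states V - target_states. v x = -1 + measure_pmf.expectation (policy_kernel T \<pi> x) v)"
  unfolding is_value_function_def sum_product_transition by auto

locale product_mdp =
  fixes T :: "'s::finite \<Rightarrow> 'a::finite \<Rightarrow> 's pmf" and V :: "'s set"
begin

sublocale closed_chain "policy_kernel T \<pi>" "ext_states V" target_states for \<pi> :: "'s ext_state \<Rightarrow> 'a"
  by unfold_locales (rule set_pmf_product_transition_subset)

text \<open>The support form of \<open>proper\<close>. It is the invariant carried through the
  iteration.\<close>

definition reaches_targets :: "('s ext_state \<Rightarrow> 'a) \<Rightarrow> bool" where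
  "reaches_targets \<pi> \<longleftrightarrow> (\<forall>x \<in> ext_states V. reaches (policy_kernel T \<pi>) target_states x)"

lemma reaches_targets_if_proper: "proper T V \<pi> \<Longrightarrow> reaches_targets \<pi>"
  unfolding proper_def policy_paths_def reaches_targets_def by (blast intro: reaches_if_measure_pos)

lemma expectation_eqI:
  fixes f g :: "'s ext_state \<Rightarrow> real"
  assumes "x \<in> ext_states V" "\<And>y. y \<in> ext_states V \<Longrightarrow> f y = g y"
  shows "measure_pmf.expectation (product_transition T x a) f = measure_pmf.expectation (product_transition T x a) g"
proof (rule integral_cong_AE)
  have "f y = g y" if "y \<in> set_pmf (product_transition T x a)" for y
    using assms(2) subsetD[OF set_pmf_product_transition_subset[OF assms(1)] that] by simp
  then show "AE y in product_transition T x a. f y = g y"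
    by (simp add: AE_measure_pmf_iff)
qed simp_all

text \<open>The difference of two solutions is harmonic off the targets and zero on them; the
  maximum principle applies in both orders. Outside \<open>ext_states V\<close> extensionality
  decides.\<close>

lemma is_value_function_unique:
  assumes "reaches_targets \<pi>" "is_value_function T V \<pi> v" "is_value_function T V \<pi> v'"
  shows "v = v'"
proof (rule extensionalityI)
  show "v \<in> extensional (ext_states V)" "v' \<in> extensional (ext_states V)"
    using assms by (auto simp: is_value_function_iff)
  have "u x - u' x \<le> 0"
    if "is_value_function T V \<pi> u" "is_value_function T V \<pi> u'" "x \<in> ext_states V" for u u' x
  proof (rule subharmonic_nonpos[of "\<lambda>x. u x - u' x" \<pi>])
    fix y assume "y \<in> ext_states V \<inter> target_states"
    then have "u y = 0" "u' y = 0"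
      using that(1,2) unfolding is_value_function_iff by blast+
    then show "u y - u' y \<le> 0"
      by simp
  next
    fix y assume "y \<in> ext_states V - target_states"
    then have "u y = -1 + measure_pmf.expectation (policy_kernel T \<pi> y) u"
      "u' y = -1 + measure_pmf.expectation (policy_kernel T \<pi> y) u'"
      using that(1,2) unfolding is_value_function_iff by blast+
    then show "u y - u' y \<le> measure_pmf.expectation (policy_kernel T \<pi> y) (\<lambda>x. u x - u' x)"
      by simp
  qed (use assms(1) that in \<open>auto simp: reaches_targets_def\<close>)
  from this[OF assms(2,3)] this[OF assms(3,2)] show "v x = v' x" if "x \<in> ext_states V" for x
    using that by (simp add: antisym)
qed

lemma is_value_function_exists:
  assumes "reaches_targets \<pi>"
  shows "\<exists>v. is_value_function T V \<pi> v"
proof -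
  have reaches: "reaches (policy_kernel T \<pi>) target_states x" if "x \<in> ext_states V" for x
    using assms that by (simp add: reaches_targets_def)
  obtain u :: "'s ext_state \<Rightarrow> real" where u:
    "(\<forall>x\<in>ext_states V - target_states. u x = -1 + measure_pmf.expectation (policy_kernel T \<pi> x) u) \<and>
      (\<forall>x. x \<notin> ext_states V - target_states \<longrightarrow> u x = 0)"
    using poisson_equation_solvable[OF reaches, where c = "\<lambda>_. -1"] ..
  have u1: "\<forall>x\<in>ext_states V \<inter> target_states. u x = 0"
    using conjunct2[OF u] by blast
  note u2 = conjunct1[OF u]
  \<comment> \<open>The solution is restricted to become extensional. No transition leaves
    \<open>ext_states V\<close>, so its expectations are unaffected.\<close>
  have "measure_pmf.expectation (policy_kernel T \<pi> x) (restrict u (ext_states V)) =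
      measure_pmf.expectation (policy_kernel T \<pi> x) u" if "x \<in> ext_states V" for x
    using that by (rule expectation_eqI) simp
  then have "is_value_function T V \<pi> (restrict u (ext_states V))"
    unfolding is_value_function_iff using u1 u2 by simp
  then show ?thesis
    by (intro exI)
qed

lemma is_value_function_value_function:
  assumes "reaches_targets \<pi>"
  shows "is_value_function T V \<pi> (value_function T V \<pi>)"
proof -
  have "\<exists>!v. is_value_function T V \<pi> v"
    using is_value_function_exists[OF assms] is_value_function_unique[OF assms] by blast
  then show ?thesis
    unfolding value_function_def by (rule theI')
qed

lemma value_function_target:
  "reaches_targets \<pi> \<Longrightarrow> x \<in> ext_states V \<Longrightarrow> x \<in> target_states \<Longrightarrow> value_function T V \<pi> x = 0"
  using is_value_function_value_function[of \<pi>] unfolding is_value_function_iff by blast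

lemma value_function_nontarget:
  "reaches_targets \<pi> \<Longrightarrow> x \<in> ext_states V \<Longrightarrow> x \<notin> target_states \<Longrightarrow>
    value_function T V \<pi> x = -1 + measure_pmf.expectation (policy_kernel T \<pi> x) (value_function T V \<pi>)"
  using is_value_function_value_function[of \<pi>] unfolding is_value_function_iff by blast

lemma value_function_nonpos:
  assumes "reaches_targets \<pi>" "x \<in> ext_states V"
  shows "value_function T V \<pi> x \<le> 0"
proof (rule subharmonic_nonpos[of "value_function T V \<pi>" \<pi>])
  fix y assume "y \<in> ext_states V \<inter> target_states"
  then show "value_function T V \<pi> y \<le> 0"
    using value_function_target[OF assms(1), of y] by auto
next
  fix y assume "y \<in> ext_states V - target_states"
  then show "value_function T V \<pi> y \<le> measure_pmf.expectation (policy_kernel T \<pi> y) (value_function T V \<pi>)"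
    using value_function_nontarget[OF assms(1), of y] by simp
next
  show "reaches (policy_kernel T \<pi>) target_states y" if "y \<in> ext_states V" for y
    using assms(1) that by (simp add: reaches_targets_def)
qed (rule assms(2))

section \<open>Policy improvement and termination\<close>

context
  fixes am :: "'s ext_state \<Rightarrow> ('a \<Rightarrow> real) \<Rightarrow> 'a"
  assumes am: "argmax_operator am"
begin

text \<open>The reward is the same for all actions, so maximising the action value maximises the
  expected value of the successor.\<close>

lemma expectation_le_improve:
  assumes "x \<in> ext_states V"
  shows "measure_pmf.expectation (product_transition T x a) (value_function T V \<pi>) \<le>
    measure_pmf.expectation (policy_kernel T (improve T V am \<pi>) x) (value_function T V \<pi>)"
proof -
  let ?f = "action_value T (value_function T V \<pi>) x"
  have "?f a \<le> ?f (am x ?f)"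
    using am[unfolded argmax_operator_def, rule_format, of ?f x] by (simp add: is_arg_max_def not_less)
  then show ?thesis
    using assms by (simp add: improve_def action_value_eq)
qed

text \<open>The action of \<open>\<pi>\<close> itself attains equality by the value equation, and
  the greedy action does at least as well.\<close>

lemma value_function_le_improve_step:
  assumes "reaches_targets \<pi>" "x \<in> ext_states V - target_states"
  shows "value_function T V \<pi> x + 1 \<le>
    measure_pmf.expectation (policy_kernel T (improve T V am \<pi>) x) (value_function T V \<pi>)"
  using assms expectation_le_improve[of x "\<pi> x" \<pi>] by (simp add: value_function_nontarget)

lemma reaches_targets_improve:
  assumes "reaches_targets \<pi>"
  shows "reaches_targets (improve T V am \<pi>)"
  unfolding reaches_targets_def
  by (intro ballI reaches_if_strictly_subharmonic[of "value_function T V \<pi>"] value_function_le_improve_step[OF assms])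

text \<open>Along the new chain the old value gains at least 1 per step and the new value exactly 1,
  so their difference is subharmonic.\<close>

lemma value_function_improve:
  assumes "reaches_targets \<pi>" "x \<in> ext_states V"
  shows "value_function T V \<pi> x \<le> value_function T V (improve T V am \<pi>) x"
proof -
  let ?\<pi>' = "improve T V am \<pi>"
  have \<pi>': "reaches_targets ?\<pi>'"
    using assms(1) by (rule reaches_targets_improve)
  have "value_function T V \<pi> x - value_function T V ?\<pi>' x \<le> 0"
  proof (rule subharmonic_nonpos[of "\<lambda>x. value_function T V \<pi> x - value_function T V ?\<pi>' x" ?\<pi>'])
    fix y assume "y \<in> ext_states V - target_states"
    then show "value_function T V \<pi> y - value_function T V ?\<pi>' y \<le>
        measure_pmf.expectation (policy_kernel T ?\<pi>' y) (\<lambda>x. value_function T V \<pi> x - value_function T V ?\<pi>' x)"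
      using value_function_le_improve_step[OF assms(1), of y] value_function_nontarget[OF \<pi>', of y] by simp
  next
    fix y assume "y \<in> ext_states V \<inter> target_states"
    then show "value_function T V \<pi> y - value_function T V ?\<pi>' y \<le> 0"
      using value_function_target[OF assms(1), of y] value_function_target[OF \<pi>', of y] by simp
  next
    show "reaches (policy_kernel T ?\<pi>') target_states y" if "y \<in> ext_states V" for y
      using \<pi>' that by (simp add: reaches_targets_def)
  qed (rule assms(2))
  then show ?thesis
    by simp
qed

lemma reaches_targets_iterate:
  "reaches_targets \<pi> \<Longrightarrow> reaches_targets ((improve T V am ^^ n) \<pi>)"
  by (induction n) (auto intro: reaches_targets_improve)

lemma value_function_iterate_mono:
  assumes "reaches_targets \<pi>" "x \<in> ext_states V" "m \<le> n"
  shows "value_function T V ((improve T V am ^^ m) \<pi>) x \<le> value_function T V ((improve T V am ^^ n) \<pi>) x"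
  using assms(3)
proof (induction rule: dec_induct)
  case (step n)
  then show ?case
    using value_function_improve[OF reaches_targets_iterate[OF assms(1)] assms(2), of n] by simp
qed simp

lemma policy_iteration_terminates:
  assumes "reaches_targets \<pi>"
  shows "\<exists>n. improve T V am ((improve T V am ^^ n) \<pi>) = (improve T V am ^^ n) \<pi>"
proof -
  let ?p = "\<lambda>n. (improve T V am ^^ n) \<pi>"
  \<comment> \<open>The function type of policies is finite, so the iterates must repeat.\<close>
  have "\<not> inj ?p"
  proof
    assume "inj ?p"
    then have "finite (UNIV :: nat set)"
      by (rule finite_imageD[OF finite])
    then show False
      by simp
  qed
  then obtain i j where ij: "i < j" "?p i = ?p j"
    using linorder_injI[of ?p] by blast
  \<comment> \<open>Values never decrease, and from \<open>i\<close> to \<open>j\<close> they return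
    to where they started, so the first step leaves them unchanged.\<close>
  have "value_function T V (?p i) = value_function T V (?p (Suc i))"
  proof (rule extensionalityI)
    show "value_function T V (?p i) \<in> extensional (ext_states V)"
      "value_function T V (?p (Suc i)) \<in> extensional (ext_states V)"
      using is_value_function_value_function[OF reaches_targets_iterate[OF assms]]
      unfolding is_value_function_def by blast+
    show "value_function T V (?p i) x = value_function T V (?p (Suc i)) x" if "x \<in> ext_states V" for x
    proof (rule antisym)
      show "value_function T V (?p i) x \<le> value_function T V (?p (Suc i)) x"
        by (rule value_function_iterate_mono[OF assms that]) simp
      show "value_function T V (?p (Suc i)) x \<le> value_function T V (?p i) x"
        unfolding ij(2) by (rule value_function_iterate_mono[OF assms that]) (simp add: Suc_le_eq ij(1))
    qed
  qed
  \<comment> \<open>\<open>improve\<close> sees a policy only through its value function. The fixed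
    point is \<open>?p (Suc i)\<close>: \<open>?p i\<close> may break ties differently and still
    have the same values.\<close>
  then have "improve T V am (?p i) = improve T V am (?p (Suc i))"
    by (simp add: improve_def)
  then show ?thesis
    by (intro exI[of _ "Suc i"]) simp
qed

end

section \<open>Value functions and expected cover times\<close>

text \<open>The extended states that occur on trajectories from \<open>(s\<^sub>0, V - {s\<^sub>0})\<close>: the current
  location is never among the remaining ones. Among them, \<open>target_states\<close> is closed under
  transitions; in general it is not, as \<open>(s, {s})\<close> shows.\<close>

definition consistent_states :: "'s ext_state set" where
  "consistent_states = {(s, W). W \<subseteq> V \<and> s \<notin> W}"

lemma consistent_states_subset: "consistent_states \<subseteq> ext_states V"
  by (auto simp: consistent_states_def ext_states_def)

lemma target_iff_if_consistent: "x \<in> consistent_states \<Longrightarrow> x \<in> target_states \<longleftrightarrow> snd x = {}"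
  by (auto simp: consistent_states_def target_states_def)

lemma closed_chain_consistent: "closed_chain (policy_kernel T \<pi>) consistent_states"
  by unfold_locales (auto simp: consistent_states_def product_transition_def)

lemma consistent_covered_step:
  "x \<in> consistent_states \<Longrightarrow> snd x = {} \<Longrightarrow> y \<in> set_pmf (product_transition T x a) \<Longrightarrow> y \<in> consistent_states \<and> snd y = {}"
  by (auto simp: consistent_states_def product_transition_def)

text \<open>Value equations are posed only off the targets. This supplies the remaining case for the
  cost inequalities: covered states lead only to covered states, whose value is 0.\<close>

lemma expectation_value_function_covered:
  assumes "reaches_targets \<pi>" "x \<in> consistent_states" "snd x = {}"
  shows "measure_pmf.expectation (product_transition T x a) (value_function T V \<pi>) = 0"
proof -
  have "value_function T V \<pi> y = 0" if "y \<in> set_pmf (product_transition T x a)" for y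
    using consistent_covered_step[OF assms(2,3) that] consistent_states_subset target_iff_if_consistent
    by (intro value_function_target[OF assms(1)]) auto
  then have "measure_pmf.expectation (product_transition T x a) (value_function T V \<pi>) =
      measure_pmf.expectation (product_transition T x a) (\<lambda>_. 0)"
    by (intro antisym expectation_mono) auto
  then show ?thesis
    by simp
qed

lemma initial_consistent: "(s0, V - {s0}) \<in> consistent_states"
  by (auto simp: consistent_states_def)

text \<open>On consistent states the negated value satisfies the cost equation with cost 1 while
  something remains, and it is nonnegative, as \<open>total_cost_le\<close> requires.\<close>

lemma expected_cover_time_le:
  assumes "reaches_targets \<pi>"
  shows "expected_cover_time T V s0 \<pi> \<le> ennreal (- value_function T V \<pi> (s0, V - {s0}))"
  unfolding expected_cover_time_eq_suminf
proof (rule closed_chain.total_cost_le[OF closed_chain_consistent, where w = "\<lambda>x. - value_function T V \<pi> x"])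
  fix y :: "'s ext_state" assume y: "y \<in> consistent_states"
  then have "y \<in> ext_states V"
    using consistent_states_subset by blast
  then show "0 \<le> - value_function T V \<pi> y"
    using value_function_nonpos[OF assms] by simp
  show "indicator {y. snd y \<noteq> {}} y +
      measure_pmf.expectation (policy_kernel T \<pi> y) (\<lambda>x. - value_function T V \<pi> x) \<le> - value_function T V \<pi> y"
    using \<open>y \<in> ext_states V\<close> y target_iff_if_consistent[OF y] expectation_value_function_covered[OF assms y]
      value_function_nontarget[OF assms, of y] value_function_target[OF assms, of y]
    by (cases "snd y = {}") auto
qed (rule initial_consistent)

text \<open>\<open>\<rho>\<close> is arbitrary and may never cover \<open>V\<close>. Control of the
  remainder comes from the value of \<open>\<pi>\<close> being 0 on covered states.\<close>

lemma le_expected_cover_time: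
  assumes \<pi>: "reaches_targets \<pi>"
    and bellman: "\<And>x a. x \<in> ext_states V - target_states \<Longrightarrow>
      -1 + measure_pmf.expectation (product_transition T x a) (value_function T V \<pi>) \<le> value_function T V \<pi> x"
  shows "ennreal (- value_function T V \<pi> (s0, V - {s0})) \<le> expected_cover_time T V s0 \<rho>"
  unfolding expected_cover_time_eq_suminf
proof (rule closed_chain.le_total_cost[OF closed_chain_consistent, where w = "\<lambda>x. - value_function T V \<pi> x"])
  fix y :: "'s ext_state" assume y: "y \<in> consistent_states"
  then have "y \<in> ext_states V"
    using consistent_states_subset by blast
  then show "- value_function T V \<pi> y \<le> indicator {y. snd y \<noteq> {}} y +
      measure_pmf.expectation (policy_kernel T \<rho> y) (\<lambda>x. - value_function T V \<pi> x)"
    using y target_iff_if_consistent[OF y] expectation_value_function_covered[OF \<pi> y]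
      bellman[of y "\<rho> y"] value_function_target[OF \<pi>, of y]
    by (cases "snd y = {}") auto
next
  fix y :: "'s ext_state" assume "y \<in> consistent_states - {y. snd y \<noteq> {}}"
  then show "- value_function T V \<pi> y \<le> 0"
    using target_iff_if_consistent[of y] consistent_states_subset value_function_target[OF \<pi>, of y] by auto
qed (rule initial_consistent)

end

theorem proposition1:
  fixes T :: "'s::finite \<Rightarrow> 'a::finite \<Rightarrow> 's pmf"
    and V :: "'s set" and s0 :: 's
    and am :: "'s ext_state \<Rightarrow> ('a \<Rightarrow> real) \<Rightarrow> 'a"
    and \<pi>0 :: "'s ext_state \<Rightarrow> 'a"
  assumes "\<exists>\<sigma>. irreducible_chain (\<lambda>s. T s (\<sigma> s))"
    and "argmax_operator am"
    and "\<pi>0 \<in> policies V" and "proper T V \<pi>0"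
  shows "\<exists>\<pi>'. policy_iteration_returns T V am \<pi>0 \<pi>' \<and>
    is_arg_min (expected_cover_time T V s0) (\<lambda>\<pi>. \<pi> \<in> policies V) \<pi>'"
proof -
  interpret product_mdp T V .
  have \<pi>0: "reaches_targets \<pi>0"
    using assms(4) by (rule reaches_targets_if_proper)
  from policy_iteration_terminates[OF assms(2) this]
  obtain n where n: "improve T V am ((improve T V am ^^ n) \<pi>0) = (improve T V am ^^ n) \<pi>0" ..
  define \<pi> where "\<pi> = (improve T V am ^^ n) \<pi>0"
  have fix_\<pi>: "improve T V am \<pi> = \<pi>"
    using n by (simp add: \<pi>_def)
  have \<pi>: "reaches_targets \<pi>"
    unfolding \<pi>_def by (rule reaches_targets_iterate[OF assms(2) \<pi>0])
  \<comment> \<open>Membership comes from the fixed-point equation: \<open>\<pi>\<close> equals an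
    improved policy, which is restricted to \<open>ext_states V\<close> by construction.\<close>
  have "improve T V am \<pi> \<in> policies V"
    by (simp add: improve_def policies_def)
  then have "\<pi> \<in> policies V"
    by (simp add: fix_\<pi>)
  moreover have "expected_cover_time T V s0 \<pi> \<le> expected_cover_time T V s0 \<rho>" for \<rho>
  proof (rule order_trans[OF expected_cover_time_le[OF \<pi>] le_expected_cover_time[OF \<pi>]])
    \<comment> \<open>At a fixed point \<open>\<pi>\<close> is greedy for its own value function, so
      its value equation becomes the Bellman inequality for every action.\<close>
    fix x a assume "x \<in> ext_states V - target_states"
    then show "-1 + measure_pmf.expectation (product_transition T x a) (value_function T V \<pi>) \<le> value_function T V \<pi> x"
      using expectation_le_improve[OF assms(2), of x a \<pi>] value_function_nontarget[OF \<pi>, of x]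
      by (simp add: fix_\<pi>)
  qed
  ultimately show ?thesis
    using fix_\<pi> \<pi>_def
    by (intro exI[of _ \<pi>]) (auto simp: policy_iteration_returns_def is_arg_min_def not_less)
qed

end
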